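(* Let $U'$ be the set of positive roots of the $E_8$ root system of $8$-height $0$ and $7$-height $1$, let $W(E_6)=\langle s_1,\dots,s_6\rangle$ act on $\Omega_{U'}$ by the standard action, and let $x_0=\{\alpha_7,\ \theta_6,\ \theta_7\}\in\Omega_{U'}$, where $\theta_6=\alpha_2+\alpha_3+2\alpha_4+2\alpha_5+2\alpha_6+\alpha_7$ and $\theta_7=2\alpha_1+2\alpha_2+3\alpha_3+4\alpha_4+3\alpha_5+2\alpha_6+\alpha_7$. Let $F$ be the invariant cubic polynomial of Vavilov–Luzgarev–Pevzner, namely $F=\sum_T(-1)^{\ell(w_T)}x_T$, the sum over the $45$ elements $T$ of the $W(E_6)$-orbit of $x_0$, where $x_T=\prod_{\beta\in T}x_\beta$ and $w_T\in W(E_6)$ is an element of minimal length with $w_T\cdot x_0=T$. Then the generalized Pfaffian $\mathrm{Pf}(U')$ equals $F$.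
   Context: $\Phi$ is the root system of type $E_8$ with simple roots $\alpha_1,\dots,\alpha_8$ labelled so that $\alpha_1,\alpha_3,\alpha_4,\alpha_5,\alpha_6,\alpha_7,\alpha_8$ form a path in this order and $\alpha_2$ is joined only to $\alpha_4$; $B$ is the invariant form, $s_\alpha(\beta)=\beta-B(\alpha,\beta)\alpha$, $s_i=s_{\alpha_i}$; the $i$-height of a root is its $\alpha_i$-coefficient; $\ell$ is Coxeter length with respect to $\{s_1,\dots,s_6\}$. For a root $\alpha$, $|\alpha|$ is the positive root among $\pm\alpha$; standard action: $w\cdot R=\{|w(\alpha)|:\alpha\in R\}$. For $U\subseteq\Phi_+$: $\Omega_U$ is the set of pairwise orthogonal subsets of $U$ of maximal size; $\rho_U(R)=|\{\gamma\in U:s_\beta(\gamma)\in\Phi_+\ \forall\beta\in R\}|$; with commuting indeterminates $x_\beta$ ($\beta\in U$), $\mathrm{Pf}(U)=\sum_{R\in\Omega_U}(-1)^{\rho_U(R)}\prod_{\beta\in R}x_\beta$. *)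

theory Defs
  imports Main "HOL-Library.Poly_Mapping"
begin

section \<open>The root system of type E8\<close>

text \<open>
  A vector is given by its coordinates with respect to the simple roots: the value at
  \<open>i\<close> is the coefficient of the \<open>i\<close>-th simple root, for \<open>i\<close> in \<open>{1..8}\<close>.  Every vector
  in the integral span of the simple roots vanishes at all other indices.
\<close>

type_synonym vec = "nat \<Rightarrow> int"

definition simple_root :: "nat \<Rightarrow> vec" where
  "simple_root i = (\<lambda>_. 0)(i := 1)"

definition E8_edges :: "nat set set" where
  "E8_edges = {{1,3}, {3,4}, {4,5}, {5,6}, {6,7}, {7,8}, {2,4}}"

definition E8_cartan :: "nat \<Rightarrow> nat \<Rightarrow> int" where
  "E8_cartan i j = (if i = j then 2 else if {i, j} \<in> E8_edges then -1 else 0)"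

definition B :: "vec \<Rightarrow> vec \<Rightarrow> int" where
  "B \<alpha> \<beta> = (\<Sum>i\<in>{1..8}. \<Sum>j\<in>{1..8}. \<alpha> i * \<beta> j * E8_cartan i j)"

definition reflection :: "vec \<Rightarrow> vec \<Rightarrow> vec" where
  "reflection \<alpha> \<beta> = (\<lambda>i. \<beta> i - B \<alpha> \<beta> * \<alpha> i)"

definition word_map :: "nat list \<Rightarrow> vec \<Rightarrow> vec" where
  "word_map ws = foldr (\<lambda>i f. reflection (simple_root i) \<circ> f) ws id"

text \<open>
  Simple reflections are involutions, so the subgroup generated by those with index in \<open>I\<close>
  consists of the products of finite words in them.
\<close>

definition weyl_group :: "nat set \<Rightarrow> (vec \<Rightarrow> vec) set" where
  "weyl_group I = word_map ` lists I"

definition coxeter_length :: "nat set \<Rightarrow> (vec \<Rightarrow> vec) \<Rightarrow> nat" where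
  "coxeter_length I w = (LEAST n. \<exists>ws\<in>lists I. length ws = n \<and> word_map ws = w)"

definition roots :: "vec set" where
  "roots = {w (simple_root i) | w i. w \<in> weyl_group {1..8} \<and> i \<in> {1..8}}"

definition pos_roots :: "vec set" where
  "pos_roots = {\<alpha> \<in> roots. \<forall>i. \<alpha> i \<ge> 0}"

definition height :: "nat \<Rightarrow> vec \<Rightarrow> int" where
  "height i \<alpha> = \<alpha> i"

definition abs_root :: "vec \<Rightarrow> vec" where
  "abs_root \<alpha> = (if \<alpha> \<in> pos_roots then \<alpha> else (\<lambda>i. - \<alpha> i))"

definition std_act :: "(vec \<Rightarrow> vec) \<Rightarrow> vec set \<Rightarrow> vec set" where
  "std_act w R = (\<lambda>\<alpha>. abs_root (w \<alpha>)) ` R"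


section \<open>Generalized Pfaffians\<close>

definition orthogonal_set :: "vec set \<Rightarrow> bool" where
  "orthogonal_set R \<longleftrightarrow> (\<forall>\<alpha>\<in>R. \<forall>\<beta>\<in>R. \<alpha> \<noteq> \<beta> \<longrightarrow> B \<alpha> \<beta> = 0)"

definition Omega :: "vec set \<Rightarrow> vec set set" where
  "Omega U = {R. R \<subseteq> U \<and> orthogonal_set R \<and>
                 (\<forall>R'. R' \<subseteq> U \<and> orthogonal_set R' \<longrightarrow> card R' \<le> card R)}"

definition rho :: "vec set \<Rightarrow> vec set \<Rightarrow> nat" where
  "rho U R = card {\<gamma> \<in> U. \<forall>\<beta>\<in>R. reflection \<beta> \<gamma> \<in> pos_roots}"

text \<open>
  Polynomials with integer coefficients in commuting indeterminates indexed by vectors: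
  finitely supported functions from monomials (finitely supported exponent functions)
  to coefficients, with the convolution product.
\<close>

type_synonym root_poly = "(vec \<Rightarrow>\<^sub>0 nat) \<Rightarrow>\<^sub>0 int"

definition indet :: "vec \<Rightarrow> root_poly" where
  "indet \<beta> = Poly_Mapping.single (Poly_Mapping.single \<beta> 1) 1"

definition monomial_of :: "vec set \<Rightarrow> root_poly" where
  "monomial_of R = (\<Prod>\<beta>\<in>R. indet \<beta>)"

definition Pf :: "vec set \<Rightarrow> root_poly" where
  "Pf U = (\<Sum>R\<in>Omega U. (-1) ^ rho U R * monomial_of R)"


section \<open>The invariant cubic of type E6\<close>

definition U' :: "vec set" where
  "U' = {\<alpha> \<in> pos_roots. height 8 \<alpha> = 0 \<and> height 7 \<alpha> = 1}"

abbreviation W_E6 :: "(vec \<Rightarrow> vec) set" where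
  "W_E6 \<equiv> weyl_group {1..6}"

abbreviation len_E6 :: "(vec \<Rightarrow> vec) \<Rightarrow> nat" where
  "len_E6 \<equiv> coxeter_length {1..6}"

definition theta6 :: vec where
  "theta6 = (\<lambda>_. 0)(2 := 1, 3 := 1, 4 := 2, 5 := 2, 6 := 2, 7 := 1)"

definition theta7 :: vec where
  "theta7 = (\<lambda>_. 0)(1 := 2, 2 := 2, 3 := 3, 4 := 4, 5 := 3, 6 := 2, 7 := 1)"

definition x0 :: "vec set" where
  "x0 = {simple_root 7, theta6, theta7}"

definition orbit_x0 :: "vec set set" where
  "orbit_x0 = (\<lambda>w. std_act w x0) ` W_E6"

definition min_length_rep :: "vec set \<Rightarrow> (vec \<Rightarrow> vec) \<Rightarrow> bool" where
  "min_length_rep T w \<longleftrightarrow> w \<in> W_E6 \<and> std_act w x0 = T \<and>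
     (\<forall>v\<in>W_E6. std_act v x0 = T \<longrightarrow> len_E6 w \<le> len_E6 v)"

text \<open>
  The cubic, for a given choice \<open>w\<close> of an element \<open>w T\<close> of minimal length for each
  \<open>T\<close> in the orbit.  The choice does not matter, since only the length of \<open>w T\<close> enters.
\<close>

definition invariant_cubic :: "(vec set \<Rightarrow> vec \<Rightarrow> vec) \<Rightarrow> root_poly" where
  "invariant_cubic w = (\<Sum>T\<in>orbit_x0. (-1) ^ len_E6 (w T) * monomial_of T)"

end

theory Submission
  imports Defs
begin

text \<open>
  The roots are the vectors of norm 2, so \<open>U'\<close> consists of the roots with 7-height 1 and 8-height 0.
  The sum \<open>sigma\<close> of \<open>x0\<close> is fixed by \<open>W(E6)\<close>, and any two orthogonal \<open>\<beta>, \<gamma> \<in> U'\<close> have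
  \<open>sigma - \<beta> - \<gamma>\<close> as their only common orthogonal element of \<open>U'\<close>; hence the maximal orthogonal
  subsets of \<open>U'\<close> are the triples with sum \<open>sigma\<close>.  Lowering the height by simple reflections
  carries every such triple to \<open>x0\<close>.  A simple reflection that moves a triple changes \<open>rho\<close> by exactly
  one, and \<open>rho\<close> vanishes at \<open>x0\<close>.  Every letter of a shortest word leading from \<open>x0\<close> to \<open>T\<close> moves
  the triple it meets, so the length of the word and \<open>rho\<close> of \<open>T\<close> have the same parity.
\<close>

section \<open>The invariant form\<close>

declare One_nat_def [simp del]

lemma B_eq:
  "B a b = a 1 * (2 * b 1 - b 3) + a 2 * (2 * b 2 - b 4) + a 3 * (2 * b 3 - b 1 - b 4)
    + a 4 * (2 * b 4 - b 2 - b 3 - b 5) + a 5 * (2 * b 5 - b 4 - b 6)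
    + a 6 * (2 * b 6 - b 5 - b 7) + a 7 * (2 * b 7 - b 6 - b 8) + a 8 * (2 * b 8 - b 7)"
proof -
  have "{1..8} = {1, 2, 3, 4, 5, 6, 7, 8::nat}"
    by auto
  then show ?thesis
    by (simp add: B_def E8_cartan_def E8_edges_def doubleton_eq_iff algebra_simps)
qed

lemma B_commute: "B a b = B b a"
  by (simp add: B_eq algebra_simps)

lemma B_linear [simp]:
  "B (\<lambda>i. a i + b i) c = B a c + B b c"
  "B (\<lambda>i. a i - b i) c = B a c - B b c"
  "B (\<lambda>i. - a i) c = - B a c"
  "B (\<lambda>i. k * a i) c = k * B a c"
  "B (\<lambda>i. a i * k) c = B a c * k"
  "B c (\<lambda>i. a i + b i) = B c a + B c b"
  "B c (\<lambda>i. a i - b i) = B c a - B c b"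
  "B c (\<lambda>i. - a i) = - B c a"
  "B c (\<lambda>i. k * a i) = k * B c a"
  "B c (\<lambda>i. a i * k) = B c a * k"
  by (simp_all add: B_eq algebra_simps)

text \<open>\<open>B\<close> does not see coordinates outside 1..8, so it is definite only on
  vectors that vanish there.\<close>

definition E8_lattice :: "vec set" where
  "E8_lattice = {v. \<forall>i. i \<notin> {1..8} \<longrightarrow> v i = 0}"

lemma lattice_linear [intro]:
  "a \<in> E8_lattice \<Longrightarrow> b \<in> E8_lattice \<Longrightarrow> (\<lambda>i. a i + b i) \<in> E8_lattice"
  "a \<in> E8_lattice \<Longrightarrow> b \<in> E8_lattice \<Longrightarrow> (\<lambda>i. a i - b i) \<in> E8_lattice"
  "a \<in> E8_lattice \<Longrightarrow> (\<lambda>i. - a i) \<in> E8_lattice"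
  "a \<in> E8_lattice \<Longrightarrow> (\<lambda>i. k * a i) \<in> E8_lattice"
  by (auto simp: E8_lattice_def)

lemma range8: "i \<in> {1..8} \<longleftrightarrow> i = 1 \<or> i = 2 \<or> i = 3 \<or> i = 4 \<or> i = 5 \<or> i = 6 \<or> i = 7 \<or> i = (8::nat)"
  by auto

lemma B_eq_0_iff:
  assumes "v \<in> E8_lattice"
  shows "B v v \<le> 0 \<longleftrightarrow> v = (\<lambda>_. 0)"
proof
  assume le: "B v v \<le> 0"
  \<comment> \<open>Squares are completed along each arm of the diagram, from its end towards the
    branch node 4. The factor 60 clears denominators, and the remainder at node 4 still has a
    positive coefficient.\<close>
  have "60 * B v v = 30 * (2 * v 1 - v 3)\<^sup>2 + 10 * (3 * v 3 - 2 * v 4)\<^sup>2 + 30 * (2 * v 2 - v 4)\<^sup>2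
    + 30 * (2 * v 8 - v 7)\<^sup>2 + 10 * (3 * v 7 - 2 * v 6)\<^sup>2 + 5 * (4 * v 6 - 3 * v 5)\<^sup>2
    + 3 * (5 * v 5 - 4 * v 4)\<^sup>2 + 2 * (v 4)\<^sup>2"
    by (simp add: B_eq power2_eq_square algebra_simps)
  moreover have "0 \<le> (2 * v 1 - v 3)\<^sup>2" "0 \<le> (3 * v 3 - 2 * v 4)\<^sup>2" "0 \<le> (2 * v 2 - v 4)\<^sup>2"
    "0 \<le> (2 * v 8 - v 7)\<^sup>2" "0 \<le> (3 * v 7 - 2 * v 6)\<^sup>2" "0 \<le> (4 * v 6 - 3 * v 5)\<^sup>2"
    "0 \<le> (5 * v 5 - 4 * v 4)\<^sup>2" "0 \<le> (v 4)\<^sup>2"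
    by simp_all
  ultimately have "(2 * v 1 - v 3)\<^sup>2 = 0" "(3 * v 3 - 2 * v 4)\<^sup>2 = 0" "(2 * v 2 - v 4)\<^sup>2 = 0"
    "(2 * v 8 - v 7)\<^sup>2 = 0" "(3 * v 7 - 2 * v 6)\<^sup>2 = 0" "(4 * v 6 - 3 * v 5)\<^sup>2 = 0"
    "(5 * v 5 - 4 * v 4)\<^sup>2 = 0" "(v 4)\<^sup>2 = 0"
    using le by linarith+
  then have "v i = 0" if "i \<in> {1..8}" for i
    using that unfolding range8 by (elim disjE) simp_all
  then show "v = (\<lambda>_. 0)"
    using assms by (auto simp: E8_lattice_def fun_eq_iff)
next
  assume "v = (\<lambda>_. 0)"
  then show "B v v \<le> 0"
    by (simp add: B_eq)
qed

lemma even_B: "even (B v v)"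
proof -
  have "B v v = 2 * (v 1 * v 1 + v 2 * v 2 + v 3 * v 3 + v 4 * v 4 + v 5 * v 5 + v 6 * v 6
      + v 7 * v 7 + v 8 * v 8 - v 1 * v 3 - v 3 * v 4 - v 2 * v 4 - v 4 * v 5 - v 5 * v 6
      - v 6 * v 7 - v 7 * v 8)"
    by (simp add: B_eq algebra_simps)
  then show ?thesis
    by simp
qed

lemma B_ge_2: "v \<in> E8_lattice \<Longrightarrow> v \<noteq> (\<lambda>_. 0) \<Longrightarrow> B v v \<ge> 2"
  using B_eq_0_iff[of v] even_B[of v] by (auto elim!: evenE)

section \<open>Roots as vectors of norm 2\<close>

lemma simple_root_lattice: "i \<in> {1..8} \<Longrightarrow> simple_root i \<in> E8_lattice"
  by (auto simp: E8_lattice_def simple_root_def)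

lemma B_simple_root:
  "B (simple_root 1) v = 2 * v 1 - v 3"
  "B (simple_root 2) v = 2 * v 2 - v 4"
  "B (simple_root 3) v = 2 * v 3 - v 1 - v 4"
  "B (simple_root 4) v = 2 * v 4 - v 2 - v 3 - v 5"
  "B (simple_root 5) v = 2 * v 5 - v 4 - v 6"
  "B (simple_root 6) v = 2 * v 6 - v 5 - v 7"
  "B (simple_root 7) v = 2 * v 7 - v 6 - v 8"
  "B (simple_root 8) v = 2 * v 8 - v 7"
  by (simp_all add: B_eq simple_root_def)

lemma B_simple_root_self: "i \<in> {1..8} \<Longrightarrow> B (simple_root i) (simple_root i) = 2"
  unfolding range8 by (elim disjE) (simp_all add: B_eq simple_root_def)

lemma B_sum_simple: "B v u = (\<Sum>i\<in>{1..8}. v i * B (simple_root i) u)"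
proof -
  have "{1..8} = {1, 2, 3, 4, 5, 6, 7, 8::nat}"
    by auto
  then show ?thesis
    by (simp add: B_simple_root B_eq[of v u])
qed

lemma B_reflection_right: "B u (reflection a v) = B u v - B a v * B u a"
  by (simp add: reflection_def)

lemma B_reflection_left: "B (reflection a u) v = B u v - B a u * B a v"
  by (simp add: reflection_def)

lemma reflection_involution:
  assumes "B a a = 2"
  shows "reflection a (reflection a v) = v"
  using assms by (simp add: B_reflection_right reflection_def[of a "reflection a v"])
    (simp add: reflection_def)

lemma B_reflection:
  assumes "B a a = 2"
  shows "B (reflection a u) (reflection a v) = B u v"
  using assms by (simp add: B_reflection_left B_reflection_right B_commute[of u a] algebra_simps)

lemma reflection_lattice:
  "a \<in> E8_lattice \<Longrightarrow> v \<in> E8_lattice \<Longrightarrow> reflection a v \<in> E8_lattice"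
  by (auto simp: reflection_def E8_lattice_def)

lemma reflection_simple_root_nth: "k \<noteq> i \<Longrightarrow> reflection (simple_root i) v k = v k"
  by (simp add: reflection_def simple_root_def)

section \<open>Words in simple reflections as isometries of the lattice\<close>

lemma word_map_simps [simp]:
  "word_map [] = id"
  "word_map (i # ws) = reflection (simple_root i) \<circ> word_map ws"
  by (simp_all add: word_map_def)

lemma word_map_append: "word_map (us @ vs) = word_map us \<circ> word_map vs"
  by (induction us) (simp_all add: comp_assoc)

lemma word_map_rev:
  assumes "ws \<in> lists {1..8}"
  shows "word_map (rev ws) (word_map ws v) = v"
  using assms
  by (induction ws) (simp_all add: word_map_append reflection_involution B_simple_root_self)

lemma B_word_map:
  assumes "ws \<in> lists {1..8}"
  shows "B (word_map ws u) (word_map ws v) = B u v"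
  using assms by (induction ws) (simp_all add: B_reflection B_simple_root_self)

lemma word_map_lattice:
  assumes "ws \<in> lists {1..8}" "v \<in> E8_lattice"
  shows "word_map ws v \<in> E8_lattice"
  using assms by (induction ws) (simp_all add: reflection_lattice simple_root_lattice)

lemma word_map_nth:
  assumes "ws \<in> lists I" "k \<notin> I"
  shows "word_map ws v k = v k"
  using assms by (induction ws) (auto, metis reflection_simple_root_nth)

text \<open>The positive and negative parts of a vector pair nonpositively, and the form is even and
  positive definite, so the two parts of a vector of norm 2 cannot both be nonzero.\<close>

lemma norm_2_nonneg:
  assumes "v \<in> E8_lattice" "B v v = 2" "v k > 0"
  shows "v i \<ge> 0"
proof (rule ccontr)
  assume "\<not> v i \<ge> 0"
  define p n where "p = (\<lambda>i. max (v i) 0)" and "n = (\<lambda>i. max (- v i) 0)"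
  have "p k \<noteq> 0" "n i \<noteq> 0"
    using \<open>v k > 0\<close> \<open>\<not> v i \<ge> 0\<close> by (simp_all add: p_def n_def)
  then have "p \<noteq> (\<lambda>_. 0)" "n \<noteq> (\<lambda>_. 0)"
    by auto
  moreover have "p \<in> E8_lattice" "n \<in> E8_lattice"
    using assms by (auto simp: E8_lattice_def p_def n_def)
  ultimately have "B p p \<ge> 2" "B n n \<ge> 2"
    by (auto intro: B_ge_2)
  moreover have "B p n \<le> 0"
    unfolding B_def
  proof (intro sum_nonpos)
    fix i j
    \<comment> \<open>On the diagonal \<open>p i\<close> or \<open>n i\<close> vanishes; off the
      diagonal the Cartan entries are nonpositive.\<close>
    show "p i * n j * E8_cartan i j \<le> 0"
      by (cases "i = j")
        (auto simp: p_def n_def E8_cartan_def max_def mult_le_0_iff zero_le_mult_iff)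
  qed
  moreover have "v = (\<lambda>i. p i - n i)"
    by (auto simp: p_def n_def)
  then have "B v v = B p p + B n n - 2 * B p n"
    by (simp add: B_commute[of n p])
  ultimately show False
    using assms by simp
qed

lemma exists_B_simple_root_pos:
  assumes "B v v = 2"
  shows "\<exists>i\<in>{1..8}. v i * B (simple_root i) v > 0"
proof (rule ccontr)
  assume "\<not> ?thesis"
  then have "B v v \<le> 0"
    unfolding B_sum_simple[of v v] by (intro sum_nonpos) force
  with assms show False
    by simp
qed

text \<open>The difference has norm 4 - 2 \<open>B u v\<close>, so this is the equality case of
  Cauchy-Schwarz. It identifies a root from a single inner product, as done later for
  \<open>third\<close>, \<open>simple_root 7\<close> and \<open>theta6\<close>.\<close>

lemma B_eq_2_iff:
  assumes "u \<in> E8_lattice" "v \<in> E8_lattice" "B u u = 2" "B v v = 2"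
  shows "B u v \<ge> 2 \<longleftrightarrow> u = v"
proof -
  have "B u v \<ge> 2 \<longleftrightarrow> B (\<lambda>i. u i - v i) (\<lambda>i. u i - v i) \<le> 0"
    using assms by (simp add: B_commute[of v u])
  also have "\<dots> \<longleftrightarrow> u = v"
    using assms by (subst B_eq_0_iff) (auto simp: fun_eq_iff)
  finally show ?thesis .
qed

section \<open>Lattice vectors of norm 2 are roots\<close>

lemma in_roots_iff:
  "v \<in> roots \<longleftrightarrow> (\<exists>ws\<in>lists {1..8}. \<exists>j\<in>{1..8}. v = word_map ws (simple_root j))"
  unfolding roots_def weyl_group_def by blast

lemma simple_root_in_roots: "i \<in> {1..8} \<Longrightarrow> simple_root i \<in> roots"
  unfolding in_roots_iff by (rule bexI[of _ "[]"]) auto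

lemma reflection_in_roots:
  assumes "i \<in> {1..8}" "v \<in> roots"
  shows "reflection (simple_root i) v \<in> roots"
proof -
  obtain ws j where "ws \<in> lists {1..8}" "j \<in> {1..8}" "v = word_map ws (simple_root j)"
    using assms unfolding in_roots_iff by blast
  then show ?thesis
    using assms unfolding in_roots_iff by (intro bexI[of _ "i # ws"] bexI[of _ j]) auto
qed

text \<open>Induction on the coordinate sum. Some i has positive coordinate and positive product
  with v; unless v is that simple root the product is 1, so the reflection lowers just this
  coordinate, by one, and stays nonnegative.\<close>

lemma nonneg_norm_2_in_roots:
  assumes "v \<in> E8_lattice" "B v v = 2" "\<And>i. v i \<ge> 0"
  shows "v \<in> roots"
  using assms
proof (induction "nat (\<Sum>i\<in>{1..8}. v i)" arbitrary: v rule: less_induct)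
  case less
  obtain i where i: "i \<in> {1..8}" "v i * B (simple_root i) v > 0"
    using exists_B_simple_root_pos less.prems by blast
  then have pos: "v i > 0" "B (simple_root i) v > 0"
    using less.prems(3)[of i] by (auto simp: zero_less_mult_iff)
  show ?case
  proof (cases "v = simple_root i")
    case True
    then show ?thesis
      using i simple_root_in_roots by simp
  next
    case False
    then have B1: "B (simple_root i) v = 1"
      using B_eq_2_iff[of "simple_root i" v] less.prems i pos
      by (fastforce simp: B_simple_root_self simple_root_lattice)
    let ?u = "reflection (simple_root i) v"
    have u: "?u = v(i := v i - 1)"
      using B1 by (auto simp: reflection_def simple_root_def)
    have "(\<Sum>j\<in>{1..8}. ?u j) < (\<Sum>j\<in>{1..8}. v j)"
      using i unfolding u by (intro sum_strict_mono_ex1) auto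
    moreover have "0 \<le> (\<Sum>j\<in>{1..8}. ?u j)"
      using pos less.prems(3) unfolding u by (intro sum_nonneg) auto
    ultimately have "?u \<in> roots"
      using less.prems i pos
      by (intro less.hyps) (auto simp: u[symmetric] B_reflection B_simple_root_self
          intro!: reflection_lattice simple_root_lattice, auto simp: u)
    then show ?thesis
      using reflection_in_roots[OF i(1)] reflection_involution B_simple_root_self[OF i(1)]
      by metis
  qed
qed

text \<open>A simple root is negated by its own reflection, so appending its letter to the word
  negates the root.\<close>

lemma uminus_in_roots:
  assumes "v \<in> roots"
  shows "(\<lambda>i. - v i) \<in> roots"
proof -
  obtain ws j where w: "ws \<in> lists {1..8}" "j \<in> {1..8}" "v = word_map ws (simple_root j)"
    using assms unfolding in_roots_iff by blast
  have "word_map us (\<lambda>i. - u i) = (\<lambda>i. - word_map us u i)" for us u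
    by (induction us) (simp_all add: reflection_def)
  moreover have "reflection (simple_root j) (simple_root j) = (\<lambda>i. - simple_root j i)"
    using w by (simp add: reflection_def B_simple_root_self)
  ultimately have "(\<lambda>i. - v i) = word_map (ws @ [j]) (simple_root j)"
    using w by (simp add: word_map_append)
  then show ?thesis
    using w unfolding in_roots_iff by (intro bexI[of _ "ws @ [j]"] bexI[of _ j]) auto
qed

lemma roots_eq: "roots = {v \<in> E8_lattice. B v v = 2}"
proof (intro equalityI subsetI)
  fix v assume "v \<in> roots"
  then obtain ws j where "ws \<in> lists {1..8}" "j \<in> {1..8}" "v = word_map ws (simple_root j)"
    unfolding in_roots_iff by blast
  then show "v \<in> {v \<in> E8_lattice. B v v = 2}"
    by (metis (mono_tags, lifting) B_simple_root_self B_word_map mem_Collect_eq simple_root_lattice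
        word_map_lattice)
next
  fix v assume "v \<in> {v \<in> E8_lattice. B v v = 2}"
  then have v: "v \<in> E8_lattice" "B v v = 2"
    by auto
  show "v \<in> roots"
  proof (cases "\<exists>k. v k > 0")
    case True
    then show ?thesis
      using v norm_2_nonneg nonneg_norm_2_in_roots by blast
  next
    case False
    then have "(\<lambda>i. - v i) \<in> roots"
      using v by (intro nonneg_norm_2_in_roots) (auto simp: not_less)
    then show ?thesis
      using uminus_in_roots by fastforce
  qed
qed

section \<open>Signs of roots\<close>

lemma pos_roots_iff:
  assumes "v \<in> roots" "v k > 0"
  shows "v \<in> pos_roots"
  using assms norm_2_nonneg by (auto simp: pos_roots_def roots_eq)

lemma pos_or_neg_root:
  assumes "v \<in> roots"
  shows "(\<lambda>i. - v i) \<in> pos_roots \<longleftrightarrow> v \<notin> pos_roots"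
proof -
  have "v \<noteq> (\<lambda>_. 0)"
    using assms by (auto simp: roots_eq B_eq)
  then obtain k where k: "v k \<noteq> 0"
    by auto
  then consider "v k > 0" | "- v k > 0"
    by linarith
  then show ?thesis
  proof cases
    case 1
    then show ?thesis
      using pos_roots_iff[OF assms 1] by (auto simp: pos_roots_def intro!: exI[of _ k])
  next
    case 2
    then show ?thesis
      using pos_roots_iff[OF uminus_in_roots[OF assms] 2]
      by (auto simp: pos_roots_def intro!: exI[of _ k])
  qed
qed

text \<open>A positive root other than the i-th simple root has a positive coordinate at some other
  k, which the reflection keeps; one positive coordinate decides the sign of a root.\<close>

lemma reflection_simple_root_pos:
  assumes "v \<in> pos_roots" "v \<noteq> simple_root i" "i \<in> {1..8}"
  shows "reflection (simple_root i) v \<in> pos_roots"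
proof -
  have v: "v \<in> E8_lattice" "B v v = 2" "\<And>k. v k \<ge> 0"
    using assms by (auto simp: pos_roots_def roots_eq)
  obtain k where "k \<noteq> i" "v k > 0"
  proof (rule ccontr)
    assume "\<not> thesis"
    then have "\<forall>k. k \<noteq> i \<longrightarrow> v k = 0"
      using v(3) that by (metis order_le_less)
    then have eq: "v = (\<lambda>k. v i * simple_root i k)"
      by (auto simp: simple_root_def)
    have "B v v = v i * v i * 2"
      using B_simple_root_self[OF assms(3)] by (subst eq, subst (2) eq) simp
    then have "v i * v i = 1"
      using v by simp
    then have "v i = 1"
      using v(3)[of i] by (simp add: zmult_eq_1_iff)
    then show False
      using eq assms(2) by simp
  qed
  then show ?thesis
    using assms
    by (intro pos_roots_iff[of _ k] reflection_in_roots)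
      (auto simp: reflection_simple_root_nth pos_roots_def)
qed

section \<open>Maximal orthogonal subsets of \<open>U'\<close>\<close>

text \<open>Twice the fundamental weight of \<open>E7\<close> attached to the seventh node.\<close>

definition sigma :: vec where
  "sigma = (\<lambda>_. 0)(1 := 2, 2 := 3, 3 := 4, 4 := 6, 5 := 5, 6 := 4, 7 := 3)"

lemma sigma_lattice: "sigma \<in> E8_lattice"
  by (auto simp: E8_lattice_def sigma_def)

lemma B_sigma: "B sigma v = 2 * v 7 - 3 * v 8"
  by (simp add: B_eq sigma_def)

text \<open>Coordinate 1 at index 7 already forces positivity, so \<open>U'\<close> is cut out by
  the norm and two coordinates.\<close>

lemma U'_iff: "v \<in> U' \<longleftrightarrow> v \<in> roots \<and> v 7 = 1 \<and> v 8 = 0"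
  using pos_roots_iff[of v 7] by (auto simp: U'_def height_def pos_roots_def)

lemma U'_D:
  assumes "v \<in> U'"
  shows "v \<in> pos_roots" "v \<in> E8_lattice" "v i \<ge> 0" "v 7 = 1" "v 8 = 0" "B v v = 2"
    "B sigma v = 2" "B v sigma = 2"
  using assms by (auto simp: U'_def height_def pos_roots_def roots_eq B_sigma B_commute[of v sigma])

lemma lists_6: "ws \<in> lists {1..6} \<Longrightarrow> ws \<in> lists {1..8::nat}"
  by auto

lemma word_map_U':
  assumes "ws \<in> lists {1..6}" "v \<in> U'"
  shows "word_map ws v \<in> U'"
  using assms word_map_nth[OF assms(1)] word_map_lattice[OF lists_6] B_word_map[OF lists_6]
  by (auto simp: U'_iff roots_eq)

lemma B_simple_root_sigma: "i \<in> {1..6} \<Longrightarrow> B (simple_root i) sigma = 0"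
  by (subst B_commute) (auto simp: B_sigma simple_root_def)

lemma word_map_fixed:
  assumes "ws \<in> lists I" "\<And>i. i \<in> I \<Longrightarrow> B (simple_root i) v = 0"
  shows "word_map ws v = v"
  using assms by (induction ws) (auto simp: reflection_def)

lemma word_map_diff:
  "word_map ws (\<lambda>i. a i - b i) = (\<lambda>i. word_map ws a i - word_map ws b i)"
  by (induction ws) (simp_all add: reflection_def algebra_simps)

definition third :: "vec \<Rightarrow> vec \<Rightarrow> vec" where
  "third \<beta> \<gamma> = (\<lambda>i. sigma i - \<beta> i - \<gamma> i)"

lemma word_map_third:
  "ws \<in> lists {1..6} \<Longrightarrow> word_map ws (third \<beta> \<gamma>) = third (word_map ws \<beta>) (word_map ws \<gamma>)"
  unfolding third_def word_map_diff
  using word_map_fixed[of ws "{1..6}" sigma, OF _ B_simple_root_sigma] by simp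

text \<open>\<open>sigma\<close> has norm 6 and product 2 with every element of \<open>U'\<close>.
  Hence the third vector has norm 6 - 4 - 4 + 2 + 2 = 2 and 7-coordinate 3 - 1 - 1 = 1.\<close>

lemma B_third:
  assumes "\<beta> \<in> U'" "\<gamma> \<in> U'" "B \<beta> \<gamma> = 0"
  shows "B \<beta> (third \<beta> \<gamma>) = 0" "B \<gamma> (third \<beta> \<gamma>) = 0" "third \<beta> \<gamma> \<in> U'"
proof -
  have "B sigma sigma = 6" "sigma 7 = 3" "sigma 8 = 0"
    by (simp_all add: B_sigma) (simp_all add: sigma_def)
  then show "B \<beta> (third \<beta> \<gamma>) = 0" "B \<gamma> (third \<beta> \<gamma>) = 0" "third \<beta> \<gamma> \<in> U'"
    using U'_D[OF assms(1)] U'_D[OF assms(2)] sigma_lattice assms(3) B_commute[of \<gamma> \<beta>]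
    by (auto simp: U'_iff roots_eq third_def)
qed

text \<open>By orthogonality, the product of \<delta> with \<open>third \<beta> \<gamma>\<close>
  equals its product with \<open>sigma\<close>, which is 2, so the two roots coincide.\<close>

lemma orthogonal_third:
  assumes "\<beta> \<in> U'" "\<gamma> \<in> U'" "\<delta> \<in> U'" "B \<beta> \<gamma> = 0" "B \<beta> \<delta> = 0" "B \<gamma> \<delta> = 0"
  shows "\<delta> = third \<beta> \<gamma>"
proof -
  have "B (third \<beta> \<gamma>) \<delta> = 2"
    using assms U'_D[OF assms(3)] by (simp add: third_def)
  then show ?thesis
    using B_eq_2_iff[of "third \<beta> \<gamma>" \<delta>] B_third[OF assms(1,2,4)] U'_D assms(3) by force
qed

definition triad :: "vec \<Rightarrow> vec \<Rightarrow> vec set" where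
  "triad \<beta> \<gamma> = {\<beta>, \<gamma>, third \<beta> \<gamma>}"

lemma triad_props:
  assumes "\<beta> \<in> U'" "\<gamma> \<in> U'" "B \<beta> \<gamma> = 0"
  shows "triad \<beta> \<gamma> \<subseteq> U'" "orthogonal_set (triad \<beta> \<gamma>)" "card (triad \<beta> \<gamma>) = 3"
proof -
  have "\<beta> \<noteq> \<gamma>" "\<beta> \<noteq> third \<beta> \<gamma>" "\<gamma> \<noteq> third \<beta> \<gamma>"
    using B_third[OF assms] U'_D(6)[OF assms(1)] U'_D(6)[OF assms(2)] assms(3) by auto
  then show "triad \<beta> \<gamma> \<subseteq> U'" "orthogonal_set (triad \<beta> \<gamma>)" "card (triad \<beta> \<gamma>) = 3"
    using assms B_third[OF assms]
    by (auto simp: triad_def orthogonal_set_def B_commute[of \<gamma> \<beta>] B_commute[of "third \<beta> \<gamma>" \<beta>] B_commute[of "third \<beta> \<gamma>" \<gamma>])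
qed

lemma orthogonal_subset_triad:
  assumes "R \<subseteq> U'" "orthogonal_set R" "\<beta> \<in> R" "\<gamma> \<in> R" "\<beta> \<noteq> \<gamma>"
  shows "R \<subseteq> triad \<beta> \<gamma>" "B \<beta> \<gamma> = 0"
proof -
  show bg: "B \<beta> \<gamma> = 0"
    using assms by (auto simp: orthogonal_set_def)
  show "R \<subseteq> triad \<beta> \<gamma>"
  proof
    fix \<delta> assume "\<delta> \<in> R"
    then show "\<delta> \<in> triad \<beta> \<gamma>"
      using assms orthogonal_third[of \<beta> \<gamma> \<delta>] bg
      by (cases "\<delta> = \<beta> \<or> \<delta> = \<gamma>") (auto simp: triad_def orthogonal_set_def subset_iff)
  qed
qed

lemma card_orthogonal_le:
  assumes "R \<subseteq> U'" "orthogonal_set R"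
  shows "card R \<le> 3"
proof (cases "card R \<le> 1")
  case False
  then obtain \<beta> \<gamma> where "\<beta> \<in> R" "\<gamma> \<in> R" "\<beta> \<noteq> \<gamma>"
    by (metis card_le_Suc0_iff_eq One_nat_def card.infinite not_less_eq_eq zero_le)
  then have "R \<subseteq> triad \<beta> \<gamma>" "card (triad \<beta> \<gamma>) = 3"
    using orthogonal_subset_triad[OF assms] triad_props(3) assms(1) by blast+
  moreover have "finite (triad \<beta> \<gamma>)"
    by (simp add: triad_def)
  ultimately show ?thesis
    using card_mono by metis
\<comment> \<open>An infinite set has \<open>card\<close> 0 and falls under this trivial
  case.\<close>
qed auto

lemma x0_eq: "x0 = triad (simple_root 7) theta6"
proof -
  have "third (simple_root 7) theta6 = theta7"
    by (auto simp: third_def sigma_def theta6_def theta7_def simple_root_def)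
  then show ?thesis
    by (auto simp: triad_def x0_def)
qed

lemma x0_U':
  "simple_root 7 \<in> U'" "theta6 \<in> U'" "B (simple_root 7) theta6 = 0"
  by (auto simp: U'_iff roots_eq E8_lattice_def simple_root_def theta6_def B_eq)

text \<open>The triad \<open>x0\<close> shows that the bound 3 is attained. A maximal set therefore
  has three elements, and lies in the triad of any two of them.\<close>

lemma Omega_U': "Omega U' = {triad \<beta> \<gamma> | \<beta> \<gamma>. \<beta> \<in> U' \<and> \<gamma> \<in> U' \<and> B \<beta> \<gamma> = 0}"
proof (intro equalityI subsetI)
  fix R assume "R \<in> Omega U'"
  then have R: "R \<subseteq> U'" "orthogonal_set R" "card R \<ge> 3"
    using triad_props[OF x0_U'] by (auto simp: Omega_def)
  then obtain \<beta> \<gamma> where bg: "\<beta> \<in> R" "\<gamma> \<in> R" "\<beta> \<noteq> \<gamma>"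
    by (metis card_le_Suc0_iff_eq card.infinite not_numeral_le_zero numeral_3_eq_3 Suc_le_D le_Suc_eq
        nat.simps(3) not_less_eq_eq)
  then have "card (triad \<beta> \<gamma>) = 3"
    using R(1) orthogonal_subset_triad[OF R(1,2) bg] by (intro triad_props) auto
  then have "R = triad \<beta> \<gamma>"
    using R(3) orthogonal_subset_triad[OF R(1,2) bg]
    by (intro card_seteq) (auto simp: triad_def)
  then show "R \<in> {triad \<beta> \<gamma> | \<beta> \<gamma>. \<beta> \<in> U' \<and> \<gamma> \<in> U' \<and> B \<beta> \<gamma> = 0}"
    using R bg orthogonal_subset_triad[OF R(1,2) bg] by blast
next
  fix R assume "R \<in> {triad \<beta> \<gamma> | \<beta> \<gamma>. \<beta> \<in> U' \<and> \<gamma> \<in> U' \<and> B \<beta> \<gamma> = 0}"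
  then show "R \<in> Omega U'"
    using triad_props card_orthogonal_le by (force simp: Omega_def)
qed

text \<open>Words in the first six reflections preserve \<open>U'\<close>, which consists of
  positive roots, so \<open>abs_root\<close> acts trivially.\<close>

lemma std_act_U':
  assumes "ws \<in> lists {1..6}" "R \<subseteq> U'"
  shows "std_act (word_map ws) R = word_map ws ` R"
  using assms word_map_U' by (auto simp: std_act_def abs_root_def U'_def subset_iff image_iff)

lemma std_act_triad:
  assumes "ws \<in> lists {1..6}" "\<beta> \<in> U'" "\<gamma> \<in> U'" "B \<beta> \<gamma> = 0"
  shows "std_act (word_map ws) (triad \<beta> \<gamma>) = triad (word_map ws \<beta>) (word_map ws \<gamma>)"
  using assms by (simp add: std_act_U' triad_props) (simp add: triad_def word_map_third)

lemma std_act_Omega: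
  assumes "ws \<in> lists {1..6}" "R \<in> Omega U'"
  shows "std_act (word_map ws) R \<in> Omega U'"
  using assms std_act_triad word_map_U' B_word_map[OF lists_6] unfolding Omega_U'
  by (smt (verit) mem_Collect_eq)

lemma Omega_subset: "R \<in> Omega U' \<Longrightarrow> R \<subseteq> U'"
  by (simp add: Omega_def)

section \<open>Transitivity of \<open>W(E6)\<close>\<close>

text \<open>Reflecting in a simple root with positive product lowers the coordinate sum. The
  coordinate at k stays positive, which keeps the root positive and the sum bounded below, so the
  process ends at a root antidominant for J.\<close>

lemma descent:
  assumes "J \<subseteq> {1..8}" "k \<notin> J" "v \<in> roots" "v k > 0"
  shows "\<exists>ws\<in>lists J. \<forall>i\<in>J. B (simple_root i) (word_map ws v) \<le> 0"
  using assms(3,4)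
proof (induction "nat (\<Sum>i\<in>{1..8}. v i)" arbitrary: v rule: less_induct)
  case less
  show ?case
  proof (cases "\<forall>i\<in>J. B (simple_root i) v \<le> 0")
    case True
    then show ?thesis
      by (intro bexI[of _ "[]"]) auto
  next
    case False
    then obtain i where i: "i \<in> J" "B (simple_root i) v > 0"
      by force
    let ?u = "reflection (simple_root i) v"
    have "k \<noteq> i"
      using i(1) assms(2) by blast
    then have u: "?u \<in> roots" "?u k > 0"
      using i less.prems assms(1,2) reflection_in_roots[of i v] reflection_simple_root_nth[of k i v]
      by auto
    have "(\<Sum>j\<in>{1..8}. ?u j) < (\<Sum>j\<in>{1..8}. v j)"
      using i assms(1) by (intro sum_strict_mono_ex1 bexI[of _ i])
        (auto simp: reflection_def simple_root_def)
    moreover have "0 \<le> (\<Sum>j\<in>{1..8}. ?u j)"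
      using pos_roots_iff[OF u] by (intro sum_nonneg) (auto simp: pos_roots_def)
    ultimately obtain ws where "ws \<in> lists J" "\<forall>j\<in>J. B (simple_root j) (word_map ws ?u) \<le> 0"
      using less.hyps[of ?u] u by auto
    then show ?thesis
      \<comment> \<open>The new reflection acts first, so its letter goes at the end of the
        word.\<close>
      using i by (intro bexI[of _ "ws @ [i]"]) (auto simp: word_map_append)
  qed
qed

text \<open>Expand the norm 2 of the antidominant vector in simple roots: only index 7 can
  contribute positively, with coefficient 1, so the product with \<open>simple_root 7\<close> is at
  least 2 and the two agree.\<close>

lemma U'_descent:
  assumes "v \<in> U'"
  shows "\<exists>ws\<in>lists {1..6}. word_map ws v = simple_root 7"
proof -
  obtain ws where ws: "ws \<in> lists {1..6}" "\<forall>i\<in>{1..6}. B (simple_root i) (word_map ws v) \<le> 0"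
    using descent[of "{1..6}" 7 v] assms by (auto simp: U'_iff)
  define u where "u = word_map ws v"
  have u: "u \<in> U'"
    using ws assms word_map_U' by (simp add: u_def)
  have "{1..8} = insert 7 (insert 8 {1..6::nat})"
    by auto
  then have "B u u = B (simple_root 7) u + (\<Sum>i\<in>{1..6}. u i * B (simple_root i) u)"
    using U'_D[OF u] unfolding B_sum_simple[of u u] by simp
  moreover have "(\<Sum>i\<in>{1..6}. u i * B (simple_root i) u) \<le> 0"
    using ws U'_D[OF u] by (intro sum_nonpos mult_nonneg_nonpos) (auto simp: u_def)
  ultimately have "B (simple_root 7) u \<ge> 2"
    using U'_D(6)[OF u] by linarith
  then have "u = simple_root 7"
    using B_eq_2_iff[of "simple_root 7" u] U'_D[OF u] U'_D[OF x0_U'(1)] by auto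
  then show ?thesis
    using ws by (auto simp: u_def)
qed

lemma U'_orthogonal_descent:
  assumes "v \<in> U'" "B (simple_root 7) v = 0"
  shows "\<exists>ws\<in>lists {1..5}. word_map ws v = theta6"
proof -
  obtain ws where ws: "ws \<in> lists {1..5}" "\<forall>i\<in>{1..5}. B (simple_root i) (word_map ws v) \<le> 0"
    using descent[of "{1..5}" 7 v] assms by (auto simp: U'_iff)
  define u where "u = word_map ws v"
  have ws6: "ws \<in> lists {1..6}"
    using ws by auto
  then have u: "u \<in> U'"
    using assms word_map_U' by (simp add: u_def)
  have "word_map ws v 6 = v 6"
    using ws by (intro word_map_nth) auto
  \<comment> \<open>Orthogonality to \<open>simple_root 7\<close> reads 2 - \<open>v 6\<close> = 0,
    and the letters 1..5 leave coordinate 6 alone.\<close>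
  then have u6: "u 6 = 2"
    using U'_D[OF assms(1)] assms(2) by (simp add: u_def B_simple_root)
  have "{1..8} = insert 6 (insert 7 (insert 8 {1..5::nat}))"
    by auto
  then have "B u u = 2 * (3 - u 5) + (\<Sum>i\<in>{1..5}. u i * B (simple_root i) u)"
    using U'_D[OF u] u6 unfolding B_sum_simple[of u u] by (simp add: B_simple_root)
  moreover have "(\<Sum>i\<in>{1..5}. u i * B (simple_root i) u) \<le> 0"
    using ws U'_D[OF u] by (intro sum_nonpos mult_nonneg_nonpos) (auto simp: u_def)
  ultimately have "2 \<le> 2 * (3 - u 5)"
    using U'_D(6)[OF u] by linarith
  then have "u 5 \<le> 2"
    by simp
  have "B (simple_root i) u \<le> 0" if "i \<in> {1,2,3,4,5}" for i
    using ws that by (auto simp: u_def)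
  from this[of 1] this[of 2] this[of 3] this[of 4] this[of 5]
  have "2 * u 1 \<le> u 3" "2 * u 2 \<le> u 4" "2 * u 3 \<le> u 1 + u 4" "2 * u 4 \<le> u 2 + u 3 + u 5"
    by (simp_all add: B_simple_root)
  \<comment> \<open>The inequalities give \<open>u 1\<close> at most a third of \<open>u 4\<close>,
    and \<open>u 4\<close> at most 6/5 of \<open>u 5\<close>; so \<open>u 1\<close> is at most 4/5,
    and it is an integer.\<close>
  then have "u 1 \<le> 0"
    using \<open>u 5 \<le> 2\<close> by linarith
  moreover have "B theta6 u = u 6 - u 1 - u 8"
    by (simp add: B_eq theta6_def)
  ultimately have "B theta6 u \<ge> 2"
    using u6 U'_D[OF u] by simp
  then have "u = theta6"
    using B_eq_2_iff[of theta6 u] U'_D[OF u] U'_D[OF x0_U'(2)] by auto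
  then show ?thesis
    using ws by (auto simp: u_def)
qed

lemma orbit_x0_iff: "T \<in> orbit_x0 \<longleftrightarrow> (\<exists>ws\<in>lists {1..6}. T = std_act (word_map ws) x0)"
  by (auto simp: orbit_x0_def weyl_group_def)

lemma x0_Omega: "x0 \<in> Omega U'"
  using x0_U' by (auto simp: Omega_U' x0_eq)

text \<open>An orthogonal pair is moved in two stages: \<beta> to \<open>simple_root 7\<close>, then
  \<gamma> to \<open>theta6\<close> by the letters 1..5, which fix \<open>simple_root 7\<close>. The
  reversed word leads from \<open>x0\<close> to the given triad.\<close>

lemma orbit_x0_eq: "orbit_x0 = Omega U'"
proof (intro equalityI subsetI)
  fix T assume "T \<in> orbit_x0"
  then show "T \<in> Omega U'"
    using std_act_Omega x0_Omega by (auto simp: orbit_x0_iff)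
next
  fix T assume "T \<in> Omega U'"
  then obtain \<beta> \<gamma> where T: "T = triad \<beta> \<gamma>" "\<beta> \<in> U'" "\<gamma> \<in> U'" "B \<beta> \<gamma> = 0"
    by (auto simp: Omega_U')
  obtain us where us: "us \<in> lists {1..6}" "word_map us \<beta> = simple_root 7"
    using U'_descent[OF T(2)] by blast
  have "B (simple_root 7) (word_map us \<gamma>) = 0"
    using B_word_map[OF lists_6[OF us(1)]] us(2) T(4) by metis
  then obtain vs where vs: "vs \<in> lists {1..5}" "word_map vs (word_map us \<gamma>) = theta6"
    using U'_orthogonal_descent word_map_U'[OF us(1) T(3)] by blast
  have "word_map vs (simple_root 7) = simple_root 7"
    using vs(1) by (rule word_map_fixed) (auto simp: B_eq simple_root_def)
  then have "word_map (vs @ us) \<beta> = simple_root 7" "word_map (vs @ us) \<gamma> = theta6"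
    using us vs by (auto simp: word_map_append)
  moreover have ws: "vs @ us \<in> lists {1..6}"
    using us vs by auto
  ultimately have "word_map (rev (vs @ us)) (simple_root 7) = \<beta>"
    "word_map (rev (vs @ us)) theta6 = \<gamma>"
    using word_map_rev[OF lists_6[OF ws]] by metis+
  moreover have "rev (vs @ us) \<in> lists {1..6}"
    using ws by auto
  ultimately show "T \<in> orbit_x0"
    unfolding orbit_x0_iff x0_eq T(1) using std_act_triad x0_U' by metis
qed

section \<open>Parity of \<open>rho\<close>\<close>

lemma reflection_diff:
  "reflection a (\<lambda>i. u i - k * v i) = (\<lambda>i. reflection a u i - k * reflection a v i)"
  by (simp add: reflection_def algebra_simps)

lemma reflection_conjugate:
  assumes "B a a = 2"
  shows "reflection (reflection a \<beta>) (reflection a \<gamma>) = reflection a (reflection \<beta> \<gamma>)"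
  unfolding reflection_def[of "reflection a \<beta>"] reflection_def[of \<beta>] reflection_diff
  using assms by (simp add: B_reflection)

lemma reflection_simple_root_pos_iff:
  assumes "v \<in> roots" "v \<noteq> simple_root i" "(\<lambda>k. - v k) \<noteq> simple_root i" "i \<in> {1..8}"
  shows "reflection (simple_root i) v \<in> pos_roots \<longleftrightarrow> v \<in> pos_roots"
proof
  assume "v \<in> pos_roots"
  then show "reflection (simple_root i) v \<in> pos_roots"
    using reflection_simple_root_pos assms by blast
next
  assume pos: "reflection (simple_root i) v \<in> pos_roots"
  have "reflection (simple_root i) v \<noteq> simple_root i"
  proof
    assume "reflection (simple_root i) v = simple_root i"
    then have "v = reflection (simple_root i) (simple_root i)"
      using reflection_involution B_simple_root_self[OF assms(4)] by metis
    also have "\<dots> = (\<lambda>k. - simple_root i k)"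
      using B_simple_root_self[OF assms(4)] by (simp add: reflection_def)
    finally show False
      using assms(3) by simp
  qed
  from reflection_simple_root_pos[OF pos this assms(4)] show "v \<in> pos_roots"
    using reflection_involution B_simple_root_self[OF assms(4)] by simp
qed

text \<open>The 7-coordinates show that v is not plus or minus the simple root, so by the equality
  case neither sign of the product reaches 2.\<close>

lemma B_simple_root_U':
  assumes "i \<in> {1..6}" "v \<in> U'"
  shows "B (simple_root i) v = -1 \<or> B (simple_root i) v = 0 \<or> B (simple_root i) v = 1"
proof -
  have i: "i \<in> {1..8}" and [simp]: "simple_root i 7 = 0"
    using assms by (auto simp: simple_root_def)
  have "simple_root i \<noteq> v" "simple_root i \<noteq> (\<lambda>k. - v k)"
    using U'_D(4)[OF assms(2)] by (auto dest!: fun_cong[of _ _ 7])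
  then have "B (simple_root i) v < 2" "B (simple_root i) (\<lambda>k. - v k) < 2"
    using B_eq_2_iff[of "simple_root i" v] B_eq_2_iff[of "simple_root i" "\<lambda>k. - v k"]
      U'_D(2,6)[OF assms(2)] B_simple_root_self[OF i] simple_root_lattice[OF i]
    by (auto simp: lattice_linear)
  then show ?thesis
    by auto
qed

lemma triad_eq:
  assumes "T \<in> Omega U'" "\<beta> \<in> T" "\<gamma> \<in> T" "\<beta> \<noteq> \<gamma>"
  shows "\<beta> \<in> U'" "\<gamma> \<in> U'" "B \<beta> \<gamma> = 0" "T = triad \<beta> \<gamma>"
proof -
  have T: "T \<subseteq> U'" "orthogonal_set T" "card T = 3"
    using assms(1) triad_props by (auto simp: Omega_U')
  show bg: "\<beta> \<in> U'" "\<gamma> \<in> U'" "B \<beta> \<gamma> = 0"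
    using T assms orthogonal_subset_triad(2)[OF T(1,2)] by auto
  show "T = triad \<beta> \<gamma>"
    using orthogonal_subset_triad(1)[OF T(1,2) assms(2-4)] T(3) triad_props(3)[OF bg]
    by (intro card_seteq) (auto simp: triad_def)
qed

text \<open>The products of the simple root with the three members add up to its product with
  \<open>sigma\<close>, which is 0. Each is -1, 0 or 1 and not all vanish, so both 1 and -1
  occur.\<close>

lemma moved_triad:
  assumes "T \<in> Omega U'" "i \<in> {1..6}" "reflection (simple_root i) ` T \<noteq> T"
  obtains \<beta> \<gamma> where "\<beta> \<in> U'" "\<gamma> \<in> U'" "B \<beta> \<gamma> = 0" "T = triad \<beta> \<gamma>"
    "B (simple_root i) \<beta> = 1" "B (simple_root i) \<gamma> = -1"
proof -
  let ?b = "B (simple_root i)"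
  obtain \<beta> \<gamma> where T: "\<beta> \<in> U'" "\<gamma> \<in> U'" "B \<beta> \<gamma> = 0" "T = triad \<beta> \<gamma>"
    using assms(1) by (auto simp: Omega_U')
  have sum: "?b \<beta> + ?b \<gamma> + ?b (third \<beta> \<gamma>) = 0"
    using B_simple_root_sigma[OF assms(2)] by (simp add: third_def)
  have "\<exists>v\<in>T. ?b v \<noteq> 0"
  proof (rule ccontr)
    assume "\<not> ?thesis"
    then have "reflection (simple_root i) v = v" if "v \<in> T" for v
      using that by (simp add: reflection_def)
    then show False
      using assms(3) by auto
  qed
  then have "\<exists>v\<in>T. ?b v > 0" "\<exists>v\<in>T. ?b v < 0"
    using sum by (auto simp: T triad_def)
  moreover have "?b v = -1 \<or> ?b v = 0 \<or> ?b v = 1" if "v \<in> T" for v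
    using that Omega_subset[OF assms(1)] B_simple_root_U'[OF assms(2)] by blast
  ultimately obtain \<beta>' \<gamma>' where bg: "\<beta>' \<in> T" "\<gamma>' \<in> T" "?b \<beta>' = 1" "?b \<gamma>' = -1"
    by (metis less_numeral_extra(1,3) not_less_iff_gr_or_eq neg_less_0_iff_less)
  then have "\<beta>' \<noteq> \<gamma>'"
    by auto
  from triad_eq[OF assms(1) bg(1,2) this] bg(3,4) show thesis
    by (rule that)
qed

text \<open>Reflecting by a simple root \<open>a\<close> carries the set counted by \<open>rho\<close> for \<open>T\<close> to the one for the
  reflected triad, except at the two \<open>\<eta>\<close> with \<open>\<eta> - \<beta> = \<plusminus> a\<close> for some \<open>\<beta> \<in> T\<close>, where exactly one
  of the two sets has an additional element.\<close>

lemma even_rho_reflection: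
  assumes "finite U'" "T \<in> Omega U'" "i \<in> {1..6}" "reflection (simple_root i) ` T \<noteq> T"
  shows "even (rho U' (reflection (simple_root i) ` T)) \<longleftrightarrow> odd (rho U' T)"
proof -
  define a s where "a = simple_root i" and "s = reflection (simple_root i)"
  define C where "C R = {\<eta> \<in> U'. \<forall>\<beta>\<in>R. reflection \<beta> \<eta> \<in> pos_roots}" for R
  have i: "i \<in> {1..8}"
    using assms(3) by auto
  obtain \<beta> \<gamma> where T: "\<beta> \<in> U'" "\<gamma> \<in> U'" "B \<beta> \<gamma> = 0" "T = triad \<beta> \<gamma>"
    and ab: "B a \<beta> = 1" and ac: "B a \<gamma> = -1"
    using moved_triad[OF assms(2-4)] unfolding a_def by blast
  define \<delta> where "\<delta> = third \<beta> \<gamma>"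
  have d: "\<delta> \<in> U'" "B \<beta> \<delta> = 0" "B \<gamma> \<delta> = 0" "B \<delta> \<beta> = 0" "B \<delta> \<gamma> = 0" "B \<gamma> \<beta> = 0"
    using B_third[OF T(1-3)] T(3) by (auto simp: \<delta>_def B_commute)
  have ad: "B a \<delta> = 0"
    using ab ac B_simple_root_sigma[OF assms(3)] by (simp add: \<delta>_def third_def a_def)
  have T': "T = {\<beta>, \<gamma>, \<delta>}"
    by (simp add: T triad_def \<delta>_def)
  have aa: "B a a = 2" and a7: "a 7 = 0"
    using B_simple_root_self[OF i] assms(3) by (auto simp: a_def simple_root_def)
  have ba: "B \<beta> a = 1" "B \<gamma> a = -1" "B \<delta> a = 0"
    using ab ac ad by (simp_all add: B_commute[of _ a])
  have bb: "B \<beta> \<beta> = 2" "B \<gamma> \<gamma> = 2" "B \<delta> \<delta> = 2"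
    using T d U'_D by auto
  have s: "s \<beta> = (\<lambda>k. \<beta> k - a k)" "s \<gamma> = (\<lambda>k. \<gamma> k + a k)" "s \<delta> = \<delta>"
    using ab ac ad by (simp_all add: s_def a_def reflection_def)
  have ss: "s (s v) = v" for v
    using reflection_involution aa by (simp add: s_def a_def)
  have sU: "s v \<in> U'" if "v \<in> U'" for v
    using word_map_U'[of "[i]" v] that assms(3) by (simp add: s_def)
  have apos: "a \<in> pos_roots" and aneg: "(\<lambda>k. - a k) \<notin> pos_roots"
    using simple_root_in_roots[OF i] pos_or_neg_root[of a]
    by (auto simp: a_def pos_roots_def simple_root_def)
  have root: "reflection \<mu> \<eta> \<in> roots" if "\<mu> \<in> U'" "\<eta> \<in> U'" for \<mu> \<eta>
    using that U'_D(2,6) by (simp add: roots_eq B_reflection reflection_lattice)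

  \<comment> \<open>Conjugation by s turns \<open>reflection \<mu> \<eta>\<close> into its image
    under s, whose sign differs only for plus or minus a. Comparing 7-coordinates, these values need
    \<open>B \<mu> \<eta>\<close> = 1 and \<eta> = \<mu> + a or \<mu> - a, which are the two
    excluded cases.\<close>
  have step: "s \<eta> \<in> C (s ` T) \<longleftrightarrow> \<eta> \<in> C T" if \<eta>: "\<eta> \<in> U'" "\<eta> \<noteq> s \<beta>" "\<eta> \<noteq> s \<gamma>" for \<eta>
  proof -
    have "reflection (s \<mu>) (s \<eta>) \<in> pos_roots \<longleftrightarrow> reflection \<mu> \<eta> \<in> pos_roots" if \<mu>: "\<mu> \<in> T" for \<mu>
    proof -
      let ?v = "reflection \<mu> \<eta>"
      have U: "\<mu> \<in> U'"
        using \<mu> Omega_subset[OF assms(2)] by blast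
      have v7: "?v 7 = 1 - B \<mu> \<eta>"
        using U'_D(4)[OF U] U'_D(4)[OF \<eta>(1)] by (simp add: reflection_def)
      have "?v \<noteq> a"
      proof
        assume eq: "?v = a"
        then have 1: "B \<mu> \<eta> = 1"
          using v7 a7 by simp
        then have e: "\<eta> = (\<lambda>k. \<mu> k + a k)"
          using eq by (auto simp: reflection_def fun_eq_iff algebra_simps)
        have "B \<mu> a = -1"
          using 1 U'_D(6)[OF U] by (simp add: e)
        then have "\<mu> = \<gamma>"
          using \<mu> ba by (auto simp: T')
        then show False
          using \<eta> e s by simp
      qed
      moreover have "(\<lambda>k. - ?v k) \<noteq> a"
      proof
        assume eq: "(\<lambda>k. - ?v k) = a"
        then have 1: "B \<mu> \<eta> = 1"
          using v7 a7 by (auto dest: fun_cong[of _ _ 7])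
        then have e: "\<eta> = (\<lambda>k. \<mu> k - a k)"
          using eq by (auto simp: reflection_def fun_eq_iff algebra_simps)
        have "B \<mu> a = 1"
          using 1 U'_D(6)[OF U] by (simp add: e)
        then have "\<mu> = \<beta>"
          using \<mu> ba by (auto simp: T')
        then show False
          using \<eta> e s by simp
      qed
      ultimately show ?thesis
        using reflection_simple_root_pos_iff[OF root[OF U \<eta>(1)] _ _ i]
          reflection_conjugate[OF aa, of \<mu> \<eta>]
        by (simp add: s_def a_def)
    qed
    then show ?thesis
      using \<eta> sU by (simp add: C_def)
  qed

  have "s \<beta> \<notin> C T" "\<gamma> \<notin> C (s ` T)"
  proof -
    have "reflection \<beta> (s \<beta>) = (\<lambda>k. - a k)" "reflection (s \<gamma>) \<gamma> = (\<lambda>k. - a k)"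
      by (simp_all add: reflection_def s bb ba ac)
    then show "s \<beta> \<notin> C T" "\<gamma> \<notin> C (s ` T)"
      using aneg by (auto simp: C_def T')
  qed
  \<comment> \<open>The exceptional \<eta> are \<open>s \<beta>\<close> and
    \<open>s \<gamma>\<close>, with images \<beta> and \<gamma>. As \<open>s \<beta>\<close> and
    \<gamma> are not counted on their sides, s matches everything except possibly
    \<open>s \<gamma>\<close> before and \<beta> after the reflection.\<close>
  have "s ` (C T - {s \<gamma>}) = C (s ` T) - {\<beta>}"
  proof (intro equalityI subsetI)
    fix \<zeta> assume "\<zeta> \<in> s ` (C T - {s \<gamma>})"
    then obtain \<eta> where \<eta>: "\<eta> \<in> C T" "\<eta> \<noteq> s \<gamma>" "\<zeta> = s \<eta>"
      by blast
    moreover from this have "\<eta> \<noteq> s \<beta>" "\<eta> \<in> U'"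
      using \<open>s \<beta> \<notin> C T\<close> by (auto simp: C_def)
    ultimately show "\<zeta> \<in> C (s ` T) - {\<beta>}"
      using step ss by auto
  next
    fix \<zeta> assume \<zeta>: "\<zeta> \<in> C (s ` T) - {\<beta>}"
    then have "\<zeta> \<noteq> \<gamma>" "s \<zeta> \<in> U'"
      using \<open>\<gamma> \<notin> C (s ` T)\<close> sU by (auto simp: C_def)
    moreover from this \<zeta> have "s \<zeta> \<noteq> s \<beta>" "s \<zeta> \<noteq> s \<gamma>"
      using ss by (metis Diff_iff singletonI)+
    ultimately have "s \<zeta> \<in> C T - {s \<gamma>}"
      using step[of "s \<zeta>"] \<zeta> ss by simp
    then show "\<zeta> \<in> s ` (C T - {s \<gamma>})"
      using ss by (metis image_eqI)
  qed
  moreover have "inj_on s A" for A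
    using ss by (metis inj_onI)
  ultimately have card: "card (C T - {s \<gamma>}) = card (C (s ` T) - {\<beta>})"
    using card_image by metis

  have r: "reflection \<beta> (s \<gamma>) = (\<lambda>k. - (\<beta> k - s \<gamma> k))" "reflection \<gamma> (s \<gamma>) = a"
    "reflection \<delta> (s \<gamma>) = s \<gamma>" "reflection (s \<beta>) \<beta> = a" "reflection \<delta> \<beta> = \<beta>"
    "reflection (s \<gamma>) \<beta> = (\<lambda>k. \<beta> k - s \<gamma> k)"
    by (simp_all add: reflection_def s bb ba ab ac d T(3))
  \<comment> \<open>Whether \<open>s \<gamma>\<close> or \<beta> is counted depends only on the
    signs of two opposite roots, as the other reflections in \<open>r\<close> yield the positive
    roots a, \<open>s \<gamma>\<close> and \<beta>. So exactly one of them is counted.\<close>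
  have "(\<lambda>k. \<beta> k - s \<gamma> k) \<in> roots"
    using root[OF sU[OF T(2)] T(1)] r(6) by simp
  then have "s \<gamma> \<in> C T \<longleftrightarrow> \<beta> \<notin> C (s ` T)"
    using pos_or_neg_root[of "\<lambda>k. \<beta> k - s \<gamma> k"] apos U'_D(1) T(1,2) sU s(3)
    by (simp add: C_def T' r del: minus_diff_eq)
  moreover have "finite (C R)" for R
    using assms(1) by (simp add: C_def)
  ultimately have "card (C (s ` T)) = Suc (card (C T)) \<or> card (C T) = Suc (card (C (s ` T)))"
    using card by (metis card.remove Diff_empty Diff_insert0)
  then show ?thesis
    by (auto simp: rho_def C_def s_def)
qed

text \<open>Three coordinates conflict: positivity after \<open>theta7\<close> forces \<eta> to have
  1-coordinate at most 0, after \<open>theta6\<close> then 6-coordinate at most 0, but after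
  \<open>simple_root 7\<close> 6-coordinate at least 1.\<close>

lemma rho_x0: "rho U' x0 = 0"
proof -
  have "\<not> (\<forall>\<beta>\<in>x0. reflection \<beta> \<eta> \<in> pos_roots)" if \<eta>: "\<eta> \<in> U'" for \<eta>
  proof
    assume *: "\<forall>\<beta>\<in>x0. reflection \<beta> \<eta> \<in> pos_roots"
    have ge: "reflection \<beta> \<eta> k \<ge> 0" if "\<beta> \<in> x0" for \<beta> k
      using * that by (auto simp: pos_roots_def)
    have B: "B theta7 \<eta> = \<eta> 1" "B theta6 \<eta> = \<eta> 6 - \<eta> 1" "B (simple_root 7) \<eta> = 2 - \<eta> 6"
      using U'_D(4,5)[OF \<eta>] by (simp_all add: B_eq theta7_def theta6_def simple_root_def)
    have "reflection theta7 \<eta> 1 = - \<eta> 1" "reflection theta6 \<eta> 6 = 2 * \<eta> 1 - \<eta> 6"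
      "reflection (simple_root 7) \<eta> 7 = \<eta> 6 - 1"
      using U'_D(4)[OF \<eta>] by (simp_all add: reflection_def B)
        (simp_all add: theta7_def theta6_def simple_root_def)
    then show False
      using ge[of theta7 1] ge[of theta6 6] ge[of "simple_root 7" 7] by (simp add: x0_def)
  qed
  then have "{\<eta> \<in> U'. \<forall>\<beta>\<in>x0. reflection \<beta> \<eta> \<in> pos_roots} = {}"
    by blast
  then show ?thesis
    by (simp only: rho_def card.empty)
qed

section \<open>Counting\<close>

definition of_coords :: "int \<times> int \<times> int \<times> int \<times> int \<times> int \<Rightarrow> vec" where
  "of_coords = (\<lambda>(a, b, c, d, e, f). (\<lambda>_. 0)(1 := a, 2 := b, 3 := c, 4 := d, 5 := e, 6 := f, 7 := 1))"

text \<open>The 27 weights of the minuscule representation of E6, as the orbit of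
  \<open>simple_root 7\<close> by increasing height, ending in \<open>theta7\<close>.\<close>

definition U'_coords :: "(int \<times> int \<times> int \<times> int \<times> int \<times> int) list" where
  "U'_coords =
    [(0,0,0,0,0,0), (0,0,0,0,0,1), (0,0,0,0,1,1), (0,0,0,1,1,1), (0,1,0,1,1,1), (0,0,1,1,1,1),
     (0,1,1,1,1,1), (1,0,1,1,1,1), (1,1,1,1,1,1), (0,1,1,2,1,1), (1,1,1,2,1,1), (0,1,1,2,2,1),
     (1,1,2,2,1,1), (1,1,1,2,2,1), (0,1,1,2,2,2), (1,1,2,2,2,1), (1,1,1,2,2,2), (1,1,2,3,2,1),
     (1,1,2,2,2,2), (1,2,2,3,2,1), (1,1,2,3,2,2), (1,2,2,3,2,2), (1,1,2,3,3,2), (1,2,2,3,3,2),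
     (1,2,2,4,3,2), (1,2,3,4,3,2), (2,2,3,4,3,2)]"

lemma inj_of_coords: "inj of_coords"
proof (rule injI)
  fix x y assume "of_coords x = of_coords y"
  then have "of_coords x i = of_coords y i" for i
    by simp
  from this[of 1] this[of 2] this[of 3] this[of 4] this[of 5] this[of 6] show "x = y"
    by (cases x; cases y) (simp add: of_coords_def)
qed

lemma reflection_of_coords:
  "reflection (simple_root 1) (of_coords (a, b, c, d, e, f)) = of_coords (c - a, b, c, d, e, f)"
  "reflection (simple_root 2) (of_coords (a, b, c, d, e, f)) = of_coords (a, d - b, c, d, e, f)"
  "reflection (simple_root 3) (of_coords (a, b, c, d, e, f)) = of_coords (a, b, a + d - c, d, e, f)"
  "reflection (simple_root 4) (of_coords (a, b, c, d, e, f)) = of_coords (a, b, c, b + c + e - d, e, f)"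
  "reflection (simple_root 5) (of_coords (a, b, c, d, e, f)) = of_coords (a, b, c, d, d + f - e, f)"
  "reflection (simple_root 6) (of_coords (a, b, c, d, e, f)) = of_coords (a, b, c, d, e, e + 1 - f)"
  by (auto simp: reflection_def B_eq fun_eq_iff of_coords_def simple_root_def)

lemma U'_coords_closed:
  "\<forall>(a, b, c, d, e, f)\<in>set U'_coords.
     (c - a, b, c, d, e, f) \<in> set U'_coords \<and> (a, d - b, c, d, e, f) \<in> set U'_coords \<and>
     (a, b, a + d - c, d, e, f) \<in> set U'_coords \<and> (a, b, c, b + c + e - d, e, f) \<in> set U'_coords \<and>
     (a, b, c, d, d + f - e, f) \<in> set U'_coords \<and> (a, b, c, d, e, e + 1 - f) \<in> set U'_coords"
  by (simp add: U'_coords_def)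

lemma reflection_U'_coords:
  assumes "i \<in> {1..6}" "v \<in> of_coords ` set U'_coords"
  shows "reflection (simple_root i) v \<in> of_coords ` set U'_coords"
proof -
  obtain a b c d e f where v: "v = of_coords (a, b, c, d, e, f)" "(a, b, c, d, e, f) \<in> set U'_coords"
    using assms(2) by auto
  have "i = 1 \<or> i = 2 \<or> i = 3 \<or> i = 4 \<or> i = 5 \<or> i = 6"
    using assms(1) by auto
  then show ?thesis
    using bspec[OF U'_coords_closed v(2)] v(1) reflection_of_coords[of a b c d e f]
    by (elim disjE) simp_all
qed

text \<open>Every element is an image of \<open>simple_root 7\<close> under a word in 1..6, and the
  list contains this root and is closed under the six reflections. The converse is a norm
  check.\<close>

lemma U'_eq: "U' = of_coords ` set U'_coords"
proof (intro equalityI subsetI)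
  fix v assume "v \<in> U'"
  then obtain ws where ws: "ws \<in> lists {1..6}" "word_map ws v = simple_root 7"
    using U'_descent by blast
  have *: "word_map us (simple_root 7) \<in> of_coords ` set U'_coords" if "us \<in> lists {1..6}" for us
    using that
  proof (induction us)
    case Nil
    have "simple_root 7 = of_coords (0, 0, 0, 0, 0, 0)"
      by (auto simp: of_coords_def simple_root_def)
    then show ?case
      by (simp add: U'_coords_def)
  next
    case (Cons i us)
    then show ?case
      using reflection_U'_coords by simp
  qed
  have "rev ws \<in> lists {1..6}" "v = word_map (rev ws) (simple_root 7)"
    using word_map_rev[OF lists_6[OF ws(1)], of v] ws by auto
  then show "v \<in> of_coords ` set U'_coords"
    using * by blast
next
  fix v assume "v \<in> of_coords ` set U'_coords"
  moreover have "\<forall>(a, b, c, d, e, f)\<in>set U'_coords. a * (2 * a - c) + b * (2 * b - d) + c * (2 * c - a - d) +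
      d * (2 * d - b - c - e) + e * (2 * e - d - f) + f * (2 * f - e - 1) + (2 - f) = 2"
    by (simp add: U'_coords_def)
  ultimately show "v \<in> U'"
    by (auto simp: U'_iff roots_eq E8_lattice_def B_eq of_coords_def)
qed

lemma finite_U': "finite U'"
  by (simp add: U'_eq)

definition orthogonal_pairs :: "(vec \<times> vec) set" where
  "orthogonal_pairs = {(\<beta>, \<gamma>) \<in> U' \<times> U'. B \<beta> \<gamma> = 0}"

lemma B_of_coords:
  "B (of_coords (a, b, c, d, e, f)) (of_coords (a', b', c', d', e', f')) =
    a * (2 * a' - c') + b * (2 * b' - d') + c * (2 * c' - a' - d') +
    d * (2 * d' - b' - c' - e') + e * (2 * e' - d' - f') + f * (2 * f' - e' - 1) + (2 - f')"
  by (simp add: B_eq of_coords_def)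

lemma card_orthogonal_pairs: "card orthogonal_pairs = 270"
proof -
  define ps where "ps = filter (\<lambda>((a, b, c, d, e, f), (a', b', c', d', e', f')).
    a * (2 * a' - c') + b * (2 * b' - d') + c * (2 * c' - a' - d') +
    d * (2 * d' - b' - c' - e') + e * (2 * e' - d' - f') + f * (2 * f' - e' - 1) + (2 - f') = 0)
      (List.product U'_coords U'_coords)"
  have "orthogonal_pairs = map_prod of_coords of_coords ` set ps"
    unfolding orthogonal_pairs_def U'_eq ps_def by (force simp: B_of_coords)
  moreover have "inj (map_prod of_coords of_coords)"
    using inj_of_coords by (simp add: prod.inj_map)
  moreover have "distinct U'_coords"
    by (simp add: U'_coords_def)
  then have "distinct ps"
    unfolding ps_def by (intro distinct_filter distinct_product)
  \<comment> \<open>All 729 pairs are tested by evaluation; each of the 27 roots is orthogonal to 10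
    others.\<close>
  moreover have "length ps = 270"
    unfolding ps_def U'_coords_def by code_simp
  ultimately show ?thesis
    by (metis card_image distinct_card inj_on_subset subset_UNIV)
qed

text \<open>Every triad contains six ordered orthogonal pairs, and every pair lies in a unique triad.\<close>

lemma card_Omega_U': "card (Omega U') = 45"
proof -
  define P where "P T = {(\<beta>, \<gamma>) \<in> T \<times> T. \<beta> \<noteq> \<gamma>}" for T :: "vec set"
  have fin: "finite T" if "T \<in> Omega U'" for T
    using Omega_subset[OF that] finite_U' finite_subset by blast
  have card_P: "card (P T) = 6" if "T \<in> Omega U'" for T
  proof -
    have "card T = 3"
      using that triad_props by (auto simp: Omega_U')
    moreover have "P T = T \<times> T - (\<lambda>v. (v, v)) ` T"
      by (auto simp: P_def)
    moreover have "card ((\<lambda>v. (v, v)) ` T) = card T"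
      by (simp add: card_image inj_on_def)
    moreover have "card (T \<times> T - (\<lambda>v. (v, v)) ` T) = card (T \<times> T) - card ((\<lambda>v. (v, v)) ` T)"
      using fin[OF that] by (intro card_Diff_subset) auto
    ultimately show ?thesis
      by (simp add: card_cartesian_product)
  qed
  have "orthogonal_pairs = (\<Union>T\<in>Omega U'. P T)"
  proof (intro equalityI subsetI)
    fix p assume "p \<in> orthogonal_pairs"
    then obtain \<beta> \<gamma> where p: "p = (\<beta>, \<gamma>)" "\<beta> \<in> U'" "\<gamma> \<in> U'" "B \<beta> \<gamma> = 0"
      by (auto simp: orthogonal_pairs_def)
    moreover have "\<beta> \<noteq> \<gamma>"
      using p U'_D(6) by auto
    ultimately have "triad \<beta> \<gamma> \<in> Omega U'" "p \<in> P (triad \<beta> \<gamma>)"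
      by (auto simp: Omega_U' P_def triad_def)
    then show "p \<in> (\<Union>T\<in>Omega U'. P T)"
      by blast
  next
    fix p assume "p \<in> (\<Union>T\<in>Omega U'. P T)"
    then show "p \<in> orthogonal_pairs"
      using triad_eq by (auto simp: P_def orthogonal_pairs_def)
  qed
  moreover have "card (\<Union>T\<in>Omega U'. P T) = (\<Sum>T\<in>Omega U'. card (P T))"
  proof (intro card_UN_disjoint ballI impI)
    show "finite (Omega U')"
      using finite_subset[of "Omega U'" "Pow U'"] finite_U' by (auto simp: Omega_def)
  next
    fix T assume "T \<in> Omega U'"
    then show "finite (P T)"
      using card_P by (metis card.infinite zero_neq_numeral)
  next
    fix S T assume "S \<in> Omega U'" "T \<in> Omega U'" "S \<noteq> T"
    then show "P S \<inter> P T = {}"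
      using triad_eq(4)[of S] triad_eq(4)[of T] unfolding P_def by blast
  qed
  ultimately have "270 = card (Omega U') * 6"
    using card_orthogonal_pairs card_P by simp
  then show ?thesis
    by simp
qed

section \<open>Signs\<close>

text \<open>Minimality is among all words giving the same triple, and it passes to the tail. If the
  first letter fixed the triple of the tail, the tail would be a shorter word, so each letter flips
  the parity.\<close>

lemma even_rho_shortest:
  assumes "ws \<in> lists {1..6}"
    "\<And>vs. vs \<in> lists {1..6} \<Longrightarrow> word_map vs ` x0 = word_map ws ` x0 \<Longrightarrow> length ws \<le> length vs"
  shows "even (rho U' (word_map ws ` x0)) \<longleftrightarrow> even (length ws)"
  using assms
proof (induction ws rule: list.induct)
  case Nil
  then show ?case
    by (simp add: rho_x0)
next
  case (Cons i ws)
  let ?s = "reflection (simple_root i)" and ?T = "word_map ws ` x0"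
  have ws: "ws \<in> lists {1..6}" "i \<in> {1..6}"
    using Cons.prems(1) by auto
  have image: "word_map (i # vs) ` x0 = ?s ` word_map vs ` x0" for vs
    by (simp add: image_comp)
  have "even (rho U' ?T) \<longleftrightarrow> even (length ws)"
  proof (rule Cons.IH[OF ws(1)])
    fix vs assume "vs \<in> lists {1..6}" "word_map vs ` x0 = ?T"
    then show "length ws \<le> length vs"
      using Cons.prems(2)[of "i # vs"] ws(2) image by auto
  qed
  moreover have "?s ` ?T \<noteq> ?T"
    using Cons.prems(2)[of ws] ws(1) image[of ws] by auto
  then have "even (rho U' (?s ` ?T)) \<longleftrightarrow> odd (rho U' ?T)"
    using even_rho_reflection[OF finite_U' _ ws(2)] std_act_Omega[OF ws(1) x0_Omega]
      std_act_U'[OF ws(1) Omega_subset[OF x0_Omega]] by simp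
  ultimately show ?case
    unfolding image by simp
qed

lemma even_len_min_length_rep:
  assumes "min_length_rep T v"
  shows "even (len_E6 v) \<longleftrightarrow> even (rho U' T)"
proof -
  have v: "v \<in> W_E6" "std_act v x0 = T"
    and min: "\<And>u. u \<in> W_E6 \<Longrightarrow> std_act u x0 = T \<Longrightarrow> len_E6 v \<le> len_E6 u"
    using assms by (auto simp: min_length_rep_def)
  have "\<exists>n. \<exists>ws\<in>lists {1..6}. length ws = n \<and> word_map ws = v"
    using v(1) by (auto simp: weyl_group_def)
  then have "\<exists>ws\<in>lists {1..6}. length ws = len_E6 v \<and> word_map ws = v"
    unfolding coxeter_length_def by (rule LeastI_ex)
  then obtain ws where ws: "ws \<in> lists {1..6}" "length ws = len_E6 v" "word_map ws = v"
    by blast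
  have act: "std_act (word_map us) x0 = word_map us ` x0" if "us \<in> lists {1..6}" for us
    using std_act_U' Omega_subset x0_Omega that by blast
  have "even (rho U' (word_map ws ` x0)) \<longleftrightarrow> even (length ws)"
  proof (rule even_rho_shortest[OF ws(1)])
    fix us assume us: "us \<in> lists {1..6}" "word_map us ` x0 = word_map ws ` x0"
    have "len_E6 (word_map us) \<le> length us"
      unfolding coxeter_length_def using us(1) by (intro Least_le) blast
    \<comment> \<open>Minimality of v over group elements becomes minimality of its reduced word
      over words with the same image of \<open>x0\<close>.\<close>
    moreover have "len_E6 v \<le> len_E6 (word_map us)"
      using us ws(1,3) v(2) act[OF us(1)] act[OF ws(1)]
      by (intro min) (simp_all add: weyl_group_def)
    ultimately show "length ws \<le> length us"
      using ws(2) by simp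
  qed
  then show ?thesis
    using ws v act[OF ws(1)] by simp
qed

theorem theorem5p19:
  fixes w :: "vec set \<Rightarrow> vec \<Rightarrow> vec"
  assumes "\<And>T. T \<in> orbit_x0 \<Longrightarrow> min_length_rep T (w T)"
  shows "x0 \<in> Omega U' \<and>
    (\<forall>v\<in>W_E6. \<forall>R\<in>Omega U'. std_act v R \<in> Omega U') \<and>
    card orbit_x0 = 45 \<and>
    Pf U' = invariant_cubic w"
proof (intro conjI ballI)
  show "x0 \<in> Omega U'"
    by (rule x0_Omega)
  show "std_act v R \<in> Omega U'" if "v \<in> W_E6" "R \<in> Omega U'" for v R
    using that std_act_Omega by (auto simp: weyl_group_def)
  show "card orbit_x0 = 45"
    by (simp add: orbit_x0_eq card_Omega_U')
  \<comment> \<open>Both sums run over the same set of triples, so only the signs are left to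
    compare.\<close>
  have "(-1 :: root_poly) ^ rho U' T = (-1) ^ len_E6 (w T)" if "T \<in> Omega U'" for T
    using even_len_min_length_rep[OF assms, of T] that
    by (simp add: orbit_x0_eq minus_one_power_iff)
  then show "Pf U' = invariant_cubic w"
    unfolding Pf_def invariant_cubic_def orbit_x0_eq by simp
qed

end
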